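(* Let $G=(V,E)$ be a graph and let $S\subseteq V$ be fixed. Consider the integer program \[\min\sum_{v\in V}f_v\quad\text{subject to}\quad \sum_{v\in V}f_v\ge 1;\quad f_w+\sum_{u\in N(w)\setminus\{v\}}f_u\ge f_v\ \ \forall (v,w)\text{ with } v\in V,\ w\in N(v);\quad f_v=0\ \ \forall v\in cl(N[S]);\quad f_v\in\{0,1\}\ \ \forall v\in V.\] If $G$ has a fort $F$ with $F\cap cl(N[S])=\emptyset$, then for every optimal solution $f$ of this program, the set $\{v\in V: f_v=1\}$ is a fort of $G$ disjoint from $cl(N[S])$, and it has minimum cardinality among all forts of $G$ disjoint from $cl(N[S])$.
   Context: All graphs are finite, simple and undirected. $N(v)$ denotes the set of neighbors of $v$, $N[v]=N(v)\cup\{v\}$, $N[S]=\bigcup_{v\in S}N[v]$. A fort of $G$ is a nonempty set $F\subseteq V$ such that no vertex outside $F$ is adjacent to exactly one vertex of $F$. For a set $B$ of blue vertices (others white), the color change rule says that if a blue vertex $u$ has exactly one white neighbor $w$, then $w$ becomes blue; $cl(B)$ is the set of blue vertices obtained by applying this rule until no more changes are possible. (Such a fort disjoint from $cl(N[S])$ is called a violated fort with respect to $S$.) *)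

theory Defs
  imports Complex_Main "Graph_Theory.Pair_Digraph"
begin

text \<open>
  A finite simple undirected graph is a \<open>pair_graph\<close>: a finite vertex set with a symmetric,
  irreflexive arc relation, each edge being represented by both of its orientations.
\<close>

definition nbrs :: "'a pair_pre_digraph \<Rightarrow> 'a \<Rightarrow> 'a set" where
  "nbrs G v = {w. (v, w) \<in> parcs G}"

definition closed_nbrs :: "'a pair_pre_digraph \<Rightarrow> 'a \<Rightarrow> 'a set" where
  "closed_nbrs G v = nbrs G v \<union> {v}"

definition closed_nbrs_set :: "'a pair_pre_digraph \<Rightarrow> 'a set \<Rightarrow> 'a set" where
  "closed_nbrs_set G S = (\<Union>v\<in>S. closed_nbrs G v)"

definition fort :: "'a pair_pre_digraph \<Rightarrow> 'a set \<Rightarrow> bool" where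
  "fort G F \<longleftrightarrow> F \<noteq> {} \<and> F \<subseteq> pverts G \<and>
     \<not> (\<exists>v \<in> pverts G - F. card (nbrs G v \<inter> F) = 1)"

inductive color_change :: "'a pair_pre_digraph \<Rightarrow> 'a set \<Rightarrow> 'a set \<Rightarrow> bool" for G where
  force: "u \<in> B \<Longrightarrow> nbrs G u - B = {w} \<Longrightarrow> color_change G B (insert w B)"

text \<open>
  The final coloring does not depend on the order of the color changes; see
  \<open>zf_closure_well_defined\<close> below.
\<close>

definition zf_closure :: "'a pair_pre_digraph \<Rightarrow> 'a set \<Rightarrow> 'a set" where
  "zf_closure G B = (THE C. (color_change G)\<^sup>*\<^sup>* B C \<and> \<not> (\<exists>C'. color_change G C C'))"

lemma color_change_reach_subset:
  assumes "(color_change G)\<^sup>*\<^sup>* B C" "B \<subseteq> D" "\<not> (\<exists>D'. color_change G D D')"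
  shows "C \<subseteq> D"
  using assms(1)
proof (induction rule: rtranclp_induct)
  case base
  show ?case by (rule assms(2))
next
  case (step X Y)
  from step.hyps(2) obtain u w where u: "u \<in> X" "nbrs G u - X = {w}" "Y = insert w X"
    by (auto elim: color_change.cases)
  have "w \<in> D"
  proof (rule ccontr)
    assume "w \<notin> D"
    then have "nbrs G u - D = {w}" using u step.IH by blast
    moreover have "u \<in> D" using u(1) step.IH by blast
    ultimately show False using color_change.force[of u D G w] assms(3) by blast
  qed
  then show ?case using u step.IH by blast
qed

lemma zf_closure_well_defined:
  assumes "pair_graph G" "B \<subseteq> pverts G"
  shows "\<exists>!C. (color_change G)\<^sup>*\<^sup>* B C \<and> \<not> (\<exists>C'. color_change G C C')"
proof (rule ex_ex1I)
  interpret pair_graph G by (rule assms(1))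
  show "\<exists>C. (color_change G)\<^sup>*\<^sup>* B C \<and> \<not> (\<exists>C'. color_change G C C')"
    using assms(2)
  proof (induction "card (pverts G - B)" arbitrary: B rule: less_induct)
    case less
    show ?case
    proof (cases "\<exists>B'. color_change G B B'")
      case False
      then show ?thesis by blast
    next
      case True
      then obtain u w where uw: "u \<in> B" "nbrs G u - B = {w}"
        by (auto elim: color_change.cases)
      then have w: "w \<in> pverts G" "w \<notin> B"
        by (auto simp: nbrs_def dest: in_arcsD2)
      have "card (pverts G - insert w B) < card (pverts G - B)"
        by (rule psubset_card_mono) (use w pair_finite_verts in auto)
      then obtain C where "(color_change G)\<^sup>*\<^sup>* (insert w B) C" "\<not> (\<exists>C'. color_change G C C')"
        using less.hyps[of "insert w B"] less.prems w by blast
      with color_change.force[OF uw] show ?thesis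
        by (meson converse_rtranclp_into_rtranclp)
    qed
  qed
next
  fix C D
  assume C: "(color_change G)\<^sup>*\<^sup>* B C \<and> \<not> (\<exists>C'. color_change G C C')"
    and D: "(color_change G)\<^sup>*\<^sup>* B D \<and> \<not> (\<exists>C'. color_change G D C')"
  have sub: "B \<subseteq> X" if "(color_change G)\<^sup>*\<^sup>* B X" for X
    using that by (induction rule: rtranclp_induct) (auto elim: color_change.cases)
  show "C = D"
    using C D color_change_reach_subset sub by (metis subset_antisym)
qed

definition ip_feasible :: "'a pair_pre_digraph \<Rightarrow> 'a set \<Rightarrow> ('a \<Rightarrow> real) \<Rightarrow> bool" where
  "ip_feasible G S f \<longleftrightarrow>
     (\<Sum>v\<in>pverts G. f v) \<ge> 1 \<and>
     (\<forall>v \<in> pverts G. \<forall>w \<in> nbrs G v. f w + (\<Sum>u \<in> nbrs G w - {v}. f u) \<ge> f v) \<and>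
     (\<forall>v \<in> zf_closure G (closed_nbrs_set G S). f v = 0) \<and>
     (\<forall>v \<in> pverts G. f v \<in> {0, 1})"

definition ip_optimal :: "'a pair_pre_digraph \<Rightarrow> 'a set \<Rightarrow> ('a \<Rightarrow> real) \<Rightarrow> bool" where
  "ip_optimal G S f \<longleftrightarrow> ip_feasible G S f \<and>
     (\<forall>g. ip_feasible G S g \<longrightarrow> (\<Sum>v\<in>pverts G. f v) \<le> (\<Sum>v\<in>pverts G. g v))"

end

theory Submission
  imports Defs
begin

text \<open>
  For a 0-1 vector \<open>f\<close> the constraint of a pair \<open>(v, w)\<close> is only binding when \<open>f v = 1\<close> and
  \<open>f w = 0\<close>, and then says that \<open>w\<close> has a second neighbor in the support of \<open>f\<close>. So the supports
  of feasible vectors are exactly the forts avoiding the closure, and the objective is the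
  cardinality of the support.
\<close>

context pair_graph
begin

lemma nbrs_subset: "nbrs G v \<subseteq> pverts G"
  by (auto simp: nbrs_def dest: in_arcsD2)

lemma finite_nbrs: "finite (nbrs G v)"
  using nbrs_subset pair_finite_verts by (rule finite_subset)

lemma nbrs_sym: "w \<in> nbrs G v \<longleftrightarrow> v \<in> nbrs G w"
  using arcs_symmetric by (auto simp: nbrs_def)

text \<open>A feasible \<open>f\<close> is constrained to 0-1 values only on vertices and may be
  arbitrary elsewhere, so its support is cut down to \<open>pverts G\<close>.\<close>

lemma sum_eq_card_support:
  assumes "\<forall>v \<in> pverts G. f v \<in> {0, 1 :: real}"
  shows "(\<Sum>v\<in>pverts G. f v) = card {v \<in> pverts G. f v = 1}"
proof -
  have "(\<Sum>v\<in>pverts G. f v) = (\<Sum>v\<in>pverts G. if f v = 1 then 1 else 0)"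
    using assms by (intro sum.cong) auto
  also have "\<dots> = card {v \<in> pverts G. f v = 1}"
    by (simp add: sum.If_cases Int_def)
  finally show ?thesis .
qed

text \<open>If \<open>w\<close> outside the support had exactly one neighbor \<open>v\<close> in it,
  the constraint of the pair \<open>(v, w)\<close> would read 0 \<ge> 1.\<close>

lemma fort_support_if_ip_feasible:
  assumes "ip_feasible G S f"
  shows "fort G {v \<in> pverts G. f v = 1}"
proof -
  let ?F = "{v \<in> pverts G. f v = 1}"
  have bin: "\<forall>v \<in> pverts G. f v \<in> {0, 1}" and pos: "(\<Sum>v\<in>pverts G. f v) \<ge> 1"
    and con: "\<And>v w. v \<in> pverts G \<Longrightarrow> w \<in> nbrs G v \<Longrightarrow> f w + (\<Sum>u \<in> nbrs G w - {v}. f u) \<ge> f v"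
    using assms by (auto simp: ip_feasible_def)
  have "?F \<noteq> {}"
    using pos sum_eq_card_support[OF bin] by (metis card.empty of_nat_0 not_one_le_zero)
  moreover have "card (nbrs G w \<inter> ?F) \<noteq> 1" if w: "w \<in> pverts G - ?F" for w
  proof
    assume "card (nbrs G w \<inter> ?F) = 1"
    then obtain v where v: "nbrs G w \<inter> ?F = {v}"
      by (auto simp: card_1_singleton_iff)
    \<comment> \<open>All neighbors of \<open>w\<close> other than \<open>v\<close> are vertices
      outside the support, so binarity makes each term 0.\<close>
    have "(\<Sum>u \<in> nbrs G w - {v}. f u) = 0"
      using v bin nbrs_subset[of w] by (intro sum.neutral) blast
    moreover have "f w = 0"
      using w bin by auto
    moreover have "v \<in> pverts G" "w \<in> nbrs G v" "f v = 1"
      using v nbrs_sym by auto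
    ultimately show False
      using con[of v w] by simp
  qed
  ultimately show ?thesis
    by (auto simp: fort_def)
qed

lemma ip_feasible_indicator_if_fort:
  assumes "fort G F" and "F \<inter> zf_closure G (closed_nbrs_set G S) = {}"
  shows "ip_feasible G S (\<lambda>v. if v \<in> F then 1 else 0)" (is "ip_feasible G S ?f")
proof -
  have F: "F \<noteq> {}" "F \<subseteq> pverts G"
    and nfort: "\<And>w. w \<in> pverts G - F \<Longrightarrow> card (nbrs G w \<inter> F) \<noteq> 1"
    using assms(1) by (auto simp: fort_def)
  have "?f w + (\<Sum>u \<in> nbrs G w - {v}. ?f u) \<ge> ?f v" if w: "w \<in> nbrs G v" for v w
  proof (cases "v \<in> F \<and> w \<notin> F")
    case True
    then have "v \<in> nbrs G w \<inter> F"
      using w nbrs_sym by auto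
    moreover have "card (nbrs G w \<inter> F) \<noteq> 1"
      using nfort True w nbrs_subset by blast
    \<comment> \<open>The set \<open>nbrs G w \<inter> F\<close> contains \<open>v\<close> but is
      not a singleton; its second element \<open>u\<close> survives the removal of \<open>v\<close>
      and alone brings the sum up to 1.\<close>
    ultimately obtain u where u: "u \<in> nbrs G w - {v}" "u \<in> F"
      by (auto simp: card_1_singleton_iff)
    have "?f u \<le> (\<Sum>u \<in> nbrs G w - {v}. ?f u)"
      using u(1) finite_nbrs by (intro member_le_sum) auto
    then show ?thesis
      using u(2) True by simp
  next
    \<comment> \<open>Here \<open>?f v = 0\<close> or \<open>?f w = 1\<close>, so nonnegativity of
      the sum suffices.\<close>
    case False
    have "(\<Sum>u \<in> nbrs G w - {v}. ?f u) \<ge> 0"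
      by (rule sum_nonneg) simp
    with False show ?thesis
      by auto
  qed
  moreover have "(\<Sum>v\<in>pverts G. ?f v) \<ge> 1"
  proof -
    obtain v where v: "v \<in> F" "v \<in> pverts G"
      using F by blast
    have "?f v \<le> (\<Sum>v\<in>pverts G. ?f v)"
      using v(2) pair_finite_verts by (intro member_le_sum) auto
    then show ?thesis
      using v(1) by simp
  qed
  ultimately show ?thesis
    using assms(2) by (auto simp: ip_feasible_def)
qed

end

theorem theorem4p5:
  fixes G :: "'a pair_pre_digraph" and S :: "'a set"
  assumes "pair_graph G"
    and "S \<subseteq> pverts G"
    and "\<exists>F. fort G F \<and> F \<inter> zf_closure G (closed_nbrs_set G S) = {}"
  shows "\<forall>f. ip_optimal G S f \<longrightarrow>
           fort G {v \<in> pverts G. f v = 1} \<and>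
           {v \<in> pverts G. f v = 1} \<inter> zf_closure G (closed_nbrs_set G S) = {} \<and>
           (\<forall>F. fort G F \<and> F \<inter> zf_closure G (closed_nbrs_set G S) = {} \<longrightarrow>
                card {v \<in> pverts G. f v = 1} \<le> card F)"
proof (intro allI impI conjI)
  interpret pair_graph G by (rule assms(1))
  fix f
  assume opt: "ip_optimal G S f"
  then have feas: "ip_feasible G S f"
    by (simp add: ip_optimal_def)
  show "fort G {v \<in> pverts G. f v = 1}"
    using feas by (rule fort_support_if_ip_feasible)
  show "{v \<in> pverts G. f v = 1} \<inter> zf_closure G (closed_nbrs_set G S) = {}"
    using feas by (auto simp: ip_feasible_def)
  fix F
  assume F: "fort G F \<and> F \<inter> zf_closure G (closed_nbrs_set G S) = {}"
  let ?g = "\<lambda>v. if v \<in> F then 1 else 0 :: real"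
  have "real (card {v \<in> pverts G. f v = 1}) = (\<Sum>v\<in>pverts G. f v)"
    using feas by (intro sum_eq_card_support[symmetric]) (simp add: ip_feasible_def)
  \<comment> \<open>The indicator \<open>?g\<close> of the competing fort \<open>F\<close> is
    feasible, so optimality of \<open>f\<close> bounds its objective by that of
    \<open>?g\<close>.\<close>
  also have "\<dots> \<le> (\<Sum>v\<in>pverts G. ?g v)"
    using opt F ip_feasible_indicator_if_fort unfolding ip_optimal_def by blast
  also have "\<dots> = card {v \<in> pverts G. ?g v = 1}"
    by (rule sum_eq_card_support) simp
  \<comment> \<open>No element of \<open>F\<close> is lost, because a fort consists of
    vertices.\<close>
  also have "{v \<in> pverts G. ?g v = 1} = F"
    using F by (auto simp: fort_def)
  finally show "card {v \<in> pverts G. f v = 1} \<le> card F"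
    by simp
qed

end
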